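(* Let $M$ be a left $\mathbb O$-module. Then the set $\mathrm{Hom}_{L\mathbb O}(M,\mathbb O)$ of all $\mathbb O$-para-linear functions $f:M\to\mathbb O$ is a right $\mathbb O$-module under pointwise addition and the right scalar multiplication $$(f\odot r)(x):=f(x)r-[r,x,f]\qquad(r\in\mathbb O,\ x\in M).$$
   Context: $\mathbb O$ denotes the octonions and $\mathrm{Re}$ the real part. A left $\mathbb O$-module is a real vector space $M$ with an $\mathbb R$-bilinear scalar multiplication $\mathbb O\times M\to M$, $1m=m$, such that $r(rm)=r^2m$ for all $r\in\mathbb O$, $m\in M$ (equivalently, $[p,q,m]:=(pq)m-p(qm)$ satisfies $[p,q,m]=-[q,p,m]$). A right $\mathbb O$-module is defined symmetrically: a real vector space $N$ with an $\mathbb R$-bilinear right multiplication $N\times\mathbb O\to N$, $n1=n$, such that $(nr)r=n(r^2)$ for all $r\in\mathbb O$, $n\in N$. For a real linear $f:M\to\mathbb O$, the second associator is $[p,x,f]:=f(px)-pf(x)$ ($p\in\mathbb O$, $x\in M$). The map $f$ is $\mathbb O$-para-linear if $\mathrm{Re}\,[p,x,f]=0$ for all $p\in\mathbb O$, $x\in M$. *)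

theory Defs
  imports Complex_Main "HOL-Library.Function_Algebras"
begin

text \<open>The octonions with basis \<open>1 = e0, e1, \<dots>, e7\<close>. The library classes of algebras assume
  associativity; the type is only made
  an instance of \<^class>\<open>real_vector\<close>, \<^class>\<open>times\<close> and \<^class>\<open>one\<close>.\<close>

datatype octonion = Octonion (oct0: real) (oct1: real) (oct2: real) (oct3: real)
  (oct4: real) (oct5: real) (oct6: real) (oct7: real)

abbreviation oct_Re :: "octonion \<Rightarrow> real" where
  "oct_Re \<equiv> oct0"

instantiation octonion :: real_vector
begin

definition zero_octonion :: octonion where
  "0 = Octonion 0 0 0 0 0 0 0 0"

definition plus_octonion :: "octonion \<Rightarrow> octonion \<Rightarrow> octonion" where
  "x + y = Octonion
      (oct0 x + oct0 y) (oct1 x + oct1 y) (oct2 x + oct2 y) (oct3 x + oct3 y)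
      (oct4 x + oct4 y) (oct5 x + oct5 y) (oct6 x + oct6 y) (oct7 x + oct7 y)"

definition uminus_octonion :: "octonion \<Rightarrow> octonion" where
  "- x = Octonion
      (- oct0 x) (- oct1 x) (- oct2 x) (- oct3 x)
      (- oct4 x) (- oct5 x) (- oct6 x) (- oct7 x)"

definition minus_octonion :: "octonion \<Rightarrow> octonion \<Rightarrow> octonion" where
  "x - y = Octonion
      (oct0 x - oct0 y) (oct1 x - oct1 y) (oct2 x - oct2 y) (oct3 x - oct3 y)
      (oct4 x - oct4 y) (oct5 x - oct5 y) (oct6 x - oct6 y) (oct7 x - oct7 y)"

definition scaleR_octonion :: "real \<Rightarrow> octonion \<Rightarrow> octonion" where
  "c *\<^sub>R x = Octonion
      (c * oct0 x) (c * oct1 x) (c * oct2 x) (c * oct3 x)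
      (c * oct4 x) (c * oct5 x) (c * oct6 x) (c * oct7 x)"

instance
  by standard
    (simp_all add: zero_octonion_def plus_octonion_def uminus_octonion_def
      minus_octonion_def scaleR_octonion_def algebra_simps)

end

text \<open>Multiplication table: \<open>ei ei = -1\<close>, \<open>ei ej = - ej ei\<close> for distinct \<open>i, j > 0\<close>, and
  \<open>ei e(i+1) = e(i+3)\<close> (indices modulo 7, in \<open>{1..7}\<close>) together with the cyclic permutations
  of this identity.\<close>

instantiation octonion :: "{one, times}"
begin

definition one_octonion :: octonion where
  "1 = Octonion 1 0 0 0 0 0 0 0"

definition times_octonion :: "octonion \<Rightarrow> octonion \<Rightarrow> octonion" where
  "x * y = Octonion
      (oct0 x * oct0 y - oct1 x * oct1 y - oct2 x * oct2 y - oct3 x * oct3 y - oct4 x * oct4 y - oct5 x * oct5 y - oct6 x * oct6 y - oct7 x * oct7 y)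
      (oct0 x * oct1 y + oct1 x * oct0 y + oct2 x * oct4 y - oct4 x * oct2 y + oct5 x * oct6 y - oct6 x * oct5 y + oct3 x * oct7 y - oct7 x * oct3 y)
      (oct0 x * oct2 y + oct2 x * oct0 y + oct4 x * oct1 y - oct1 x * oct4 y + oct3 x * oct5 y - oct5 x * oct3 y + oct6 x * oct7 y - oct7 x * oct6 y)
      (oct0 x * oct3 y + oct3 x * oct0 y + oct5 x * oct2 y - oct2 x * oct5 y + oct4 x * oct6 y - oct6 x * oct4 y + oct7 x * oct1 y - oct1 x * oct7 y)
      (oct0 x * oct4 y + oct4 x * oct0 y + oct1 x * oct2 y - oct2 x * oct1 y + oct6 x * oct3 y - oct3 x * oct6 y + oct5 x * oct7 y - oct7 x * oct5 y)
      (oct0 x * oct5 y + oct5 x * oct0 y + oct2 x * oct3 y - oct3 x * oct2 y + oct7 x * oct4 y - oct4 x * oct7 y + oct6 x * oct1 y - oct1 x * oct6 y)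
      (oct0 x * oct6 y + oct6 x * oct0 y + oct3 x * oct4 y - oct4 x * oct3 y + oct1 x * oct5 y - oct5 x * oct1 y + oct7 x * oct2 y - oct2 x * oct7 y)
      (oct0 x * oct7 y + oct7 x * oct0 y + oct4 x * oct5 y - oct5 x * oct4 y + oct2 x * oct6 y - oct6 x * oct2 y + oct1 x * oct3 y - oct3 x * oct1 y)"

instance ..

end

text \<open>The following identities certify the table: by Hurwitz, a unital real algebra of dimension 8 with
  a multiplicative positive definite quadratic form is isomorphic to the octonions.\<close>

lemma octonion_mult_one:
  fixes x :: octonion
  shows "1 * x = x" "x * 1 = x"
  by (simp_all add: times_octonion_def one_octonion_def)

lemma octonion_norm_mult:
  fixes x y :: octonion
  defines "N \<equiv> \<lambda>z. (oct0 z)\<^sup>2 + (oct1 z)\<^sup>2 + (oct2 z)\<^sup>2 + (oct3 z)\<^sup>2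
                + (oct4 z)\<^sup>2 + (oct5 z)\<^sup>2 + (oct6 z)\<^sup>2 + (oct7 z)\<^sup>2"
  shows "N (x * y) = N x * N y"
  unfolding N_def times_octonion_def octonion.sel by algebra

text \<open>The underlying real vector space of a module is a subspace of an ambient real vector space,
  so that modules whose elements are functions are covered; \<open>scale\<close> is the real scalar
  multiplication. Since octonions have no power operation, \<open>r\<^sup>2\<close> is written \<open>r * r\<close>.\<close>

locale left_octonion_module = vector_space scale
  for scale :: "real \<Rightarrow> 'm::ab_group_add \<Rightarrow> 'm" +
  fixes M :: "'m set" and smul :: "octonion \<Rightarrow> 'm \<Rightarrow> 'm"
  assumes subspace_carrier: "subspace M"
    and closed: "m \<in> M \<Longrightarrow> smul r m \<in> M"
    and add_scalar: "m \<in> M \<Longrightarrow> smul (p + q) m = smul p m + smul q m"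
    and add_vector: "m \<in> M \<Longrightarrow> n \<in> M \<Longrightarrow> smul r (m + n) = smul r m + smul r n"
    and scale_scalar: "m \<in> M \<Longrightarrow> smul (c *\<^sub>R r) m = scale c (smul r m)"
    and scale_vector: "m \<in> M \<Longrightarrow> smul r (scale c m) = scale c (smul r m)"
    and one: "m \<in> M \<Longrightarrow> smul 1 m = m"
    and alternative: "m \<in> M \<Longrightarrow> smul r (smul r m) = smul (r * r) m"

locale right_octonion_module = vector_space scale
  for scale :: "real \<Rightarrow> 'n::ab_group_add \<Rightarrow> 'n" +
  fixes N :: "'n set" and smul :: "'n \<Rightarrow> octonion \<Rightarrow> 'n"
  assumes subspace_carrier: "subspace N"
    and closed: "n \<in> N \<Longrightarrow> smul n r \<in> N"
    and add_scalar: "n \<in> N \<Longrightarrow> smul n (p + q) = smul n p + smul n q"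
    and add_vector: "m \<in> N \<Longrightarrow> n \<in> N \<Longrightarrow> smul (m + n) r = smul m r + smul n r"
    and scale_scalar: "n \<in> N \<Longrightarrow> smul n (c *\<^sub>R r) = scale c (smul n r)"
    and scale_vector: "n \<in> N \<Longrightarrow> smul (scale c n) r = scale c (smul n r)"
    and one: "n \<in> N \<Longrightarrow> smul n 1 = n"
    and alternative: "n \<in> N \<Longrightarrow> smul (smul n r) r = smul n (r * r)"

definition second_associator ::
    "(octonion \<Rightarrow> 'm \<Rightarrow> 'm) \<Rightarrow> octonion \<Rightarrow> 'm \<Rightarrow> ('m \<Rightarrow> octonion) \<Rightarrow> octonion" where
  "second_associator smul p x f = f (smul p x) - p * f x"

definition para_linear ::
    "(octonion \<Rightarrow> 'm::real_vector \<Rightarrow> 'm) \<Rightarrow> ('m \<Rightarrow> octonion) \<Rightarrow> bool" where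
  "para_linear smul f \<longleftrightarrow> linear f \<and> (\<forall>p x. oct_Re (second_associator smul p x f) = 0)"

definition Hom_LO :: "(octonion \<Rightarrow> 'm::real_vector \<Rightarrow> 'm) \<Rightarrow> ('m \<Rightarrow> octonion) set" where
  "Hom_LO smul = {f. para_linear smul f}"

definition hom_smul ::
    "(octonion \<Rightarrow> 'm \<Rightarrow> 'm) \<Rightarrow> ('m \<Rightarrow> octonion) \<Rightarrow> octonion \<Rightarrow> 'm \<Rightarrow> octonion" where
  "hom_smul smul f r = (\<lambda>x. f x * r - second_associator smul r x f)"

end

theory Submission
  imports Defs
begin

text \<open>A para-linear map \<open>f\<close> satisfies \<open>Re (f (p x)) = Re (p (f x))\<close>, so it is determined by its real
  part. Since \<open>Re ((f \<odot> r) x) = Re (f (r x))\<close>, the module axioms for \<open>Hom\<close> can be checked on real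
  parts, where they reduce to the axioms of the left module \<open>M\<close>; in particular
  \<open>Re (((f \<odot> r) \<odot> r) x) = Re (f (r (r x))) = Re (f (r\<^sup>2 x))\<close>. That \<open>f \<odot> r\<close> is again para-linear
  follows from the polarised identity \<open>p (r x) + r (p x) = (p r + r p) x\<close> and the fact that the
  real part is a symmetric and associative trace on the octonions.\<close>

lemma octonion_sel_linear [simp]:
  fixes x y :: octonion
  shows "oct_Re 0 = 0"
    and "oct_Re (x + y) = oct_Re x + oct_Re y"
    and "oct_Re (x - y) = oct_Re x - oct_Re y"
    and "oct_Re (c *\<^sub>R x) = c * oct_Re x"
  by (simp_all add: zero_octonion_def plus_octonion_def minus_octonion_def scaleR_octonion_def)

lemma octonion_distrib:
  fixes x y z :: octonion
  shows "x * (y + z) = x * y + x * z"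
    and "(x + y) * z = x * z + y * z"
    and "x * (c *\<^sub>R y) = c *\<^sub>R (x * y)"
    and "(c *\<^sub>R x) * y = c *\<^sub>R (x * y)"
    and "x * 0 = 0"
  by (simp_all add: times_octonion_def plus_octonion_def scaleR_octonion_def zero_octonion_def
      algebra_simps)

lemma oct_Re_mult_commute:
  fixes x y :: octonion
  shows "oct_Re (x * y) = oct_Re (y * x)"
  by (simp add: times_octonion_def)

lemma oct_Re_mult_assoc:
  fixes x y z :: octonion
  shows "oct_Re (x * (y * z)) = oct_Re ((x * y) * z)"
  by (simp add: times_octonion_def algebra_simps)

text \<open>Taking for \<open>p\<close> the eight basis elements recovers every coordinate up to
  sign: \<open>oct_Re (p * a)\<close> is \<open>oct0 a\<close> for the unit and minus the matching
  coordinate for each imaginary basis element.\<close>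

lemma octonion_eqI_Re_mult:
  fixes a b :: octonion
  assumes "\<And>p. oct_Re (p * a) = oct_Re (p * b)"
  shows "a = b"
  using assms[of "Octonion 1 0 0 0 0 0 0 0"] assms[of "Octonion 0 1 0 0 0 0 0 0"]
    assms[of "Octonion 0 0 1 0 0 0 0 0"] assms[of "Octonion 0 0 0 1 0 0 0 0"]
    assms[of "Octonion 0 0 0 0 1 0 0 0"] assms[of "Octonion 0 0 0 0 0 1 0 0"]
    assms[of "Octonion 0 0 0 0 0 0 1 0"] assms[of "Octonion 0 0 0 0 0 0 0 1"]
  by (intro octonion.expand) (simp add: times_octonion_def)

lemma Hom_LO_iff:
  "f \<in> Hom_LO smul \<longleftrightarrow> linear f \<and> (\<forall>p x. oct_Re (f (smul p x)) = oct_Re (p * f x))"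
  by (simp add: Hom_LO_def para_linear_def second_associator_def)

lemma Hom_LO_linear: "f \<in> Hom_LO smul \<Longrightarrow> linear f"
  by (simp add: Hom_LO_iff)

lemma Hom_LO_Re: "f \<in> Hom_LO smul \<Longrightarrow> oct_Re (f (smul p x)) = oct_Re (p * f x)"
  by (simp add: Hom_LO_iff)

text \<open>Evaluating the real parts at \<open>smul p x\<close> gives
  \<open>oct_Re (p * f x) = oct_Re (p * g x)\<close> for every \<open>p\<close>, which determines
  the value at \<open>x\<close>.\<close>

lemma Hom_LO_eqI:
  assumes "f \<in> Hom_LO smul" "g \<in> Hom_LO smul" "\<And>x. oct_Re (f x) = oct_Re (g x)"
  shows "f = g"
proof
  fix x
  show "f x = g x"
    by (rule octonion_eqI_Re_mult) (metis assms Hom_LO_Re)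
qed

lemma Hom_LO_zero: "0 \<in> Hom_LO smul"
  by (auto simp: Hom_LO_iff octonion_distrib intro!: linearI)

lemma Hom_LO_add:
  "f \<in> Hom_LO smul \<Longrightarrow> g \<in> Hom_LO smul \<Longrightarrow> f + g \<in> Hom_LO smul"
  by (auto simp: Hom_LO_iff octonion_distrib linear_add linear_scale algebra_simps intro!: linearI)

lemma Hom_LO_scale: "f \<in> Hom_LO smul \<Longrightarrow> (\<lambda>x. c *\<^sub>R f x) \<in> Hom_LO smul"
  by (auto simp: Hom_LO_iff octonion_distrib linear_add linear_scale algebra_simps intro!: linearI)

text \<open>The second associator has real part zero, so only \<open>f x * r\<close> contributes,
  and its real part equals that of \<open>r * f x\<close>.\<close>

lemma oct_Re_hom_smul:
  assumes "f \<in> Hom_LO smul"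
  shows "oct_Re (hom_smul smul f r x) = oct_Re (f (smul r x))"
  using Hom_LO_Re[OF assms]
  by (simp add: hom_smul_def second_associator_def oct_Re_mult_commute)

lemma vector_space_pointwise_scaleR:
  "vector_space (\<lambda>c (f :: 'a \<Rightarrow> 'b::real_vector) x. c *\<^sub>R f x)"
  by unfold_locales (auto simp: algebra_simps)

text \<open>With carrier \<open>UNIV\<close> the membership premises of the module axioms are
  trivial, so these act as plain rewrite rules.\<close>

locale full_left_octonion_module = left_octonion_module scaleR UNIV smul
  for smul :: "octonion \<Rightarrow> 'm::real_vector \<Rightarrow> 'm"
begin

text \<open>Expand the alternative law for \<open>p + r\<close> and cancel its instances for
  \<open>p\<close> and \<open>r\<close>.\<close>

lemma smul_polarised: "smul p (smul r x) + smul r (smul p x) = smul (p * r + r * p) x"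
  using alternative[of x "p + r"] alternative[of x p] alternative[of x r]
  by (simp add: add_scalar add_vector octonion_distrib algebra_simps)

lemma linear_hom_smul:
  assumes "linear f"
  shows "linear (hom_smul smul f r)"
  using assms
  by (intro linearI)
    (simp_all add: hom_smul_def second_associator_def add_vector scale_vector linear_add
      linear_scale octonion_distrib algebra_simps)

lemma hom_smul_closed:
  assumes f: "f \<in> Hom_LO smul"
  shows "hom_smul smul f r \<in> Hom_LO smul"
proof -
  have "oct_Re (hom_smul smul f r (smul p x)) = oct_Re (p * hom_smul smul f r x)" for p x
  proof -
    have "oct_Re (f (smul p (smul r x))) + oct_Re (f (smul r (smul p x)))
        = oct_Re (f (smul (p * r + r * p) x))"
      by (metis octonion_sel_linear(2) linear_add[OF Hom_LO_linear[OF f]] smul_polarised)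
    also have "\<dots> = oct_Re ((p * r) * f x) + oct_Re ((r * p) * f x)"
      by (simp add: Hom_LO_Re[OF f] octonion_distrib)
    \<comment> \<open>In the second summand \<open>r\<close> is moved cyclically to the end under
      the real part, then the product is rebracketed.\<close>
    also have "\<dots> = oct_Re (p * (r * f x)) + oct_Re (p * (f x * r))"
      by (metis oct_Re_mult_assoc oct_Re_mult_commute)
    \<comment> \<open>Para-linearity at the point \<open>smul r x\<close> evaluates the other
      summand on the left.\<close>
    finally have "oct_Re (f (smul r (smul p x)))
        = oct_Re (p * (r * f x)) + oct_Re (p * (f x * r)) - oct_Re (p * f (smul r x))"
      by (simp add: Hom_LO_Re[OF f, of p "smul r x"])
    \<comment> \<open>Adding the subtracted term back leaves only sums, so distributivity over
      addition suffices.\<close>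
    moreover have "p * hom_smul smul f r x + p * f (smul r x) = p * (f x * r) + p * (r * f x)"
      by (simp add: hom_smul_def second_associator_def flip: octonion_distrib(1))
    then have "oct_Re (p * hom_smul smul f r x) + oct_Re (p * f (smul r x))
        = oct_Re (p * (f x * r)) + oct_Re (p * (r * f x))"
      by (metis octonion_sel_linear(2))
    ultimately show ?thesis
      by (simp add: oct_Re_hom_smul[OF f])
  qed
  then show ?thesis
    using linear_hom_smul[OF Hom_LO_linear[OF f]] by (simp add: Hom_LO_iff)
qed

lemma right_octonion_module_Hom_LO:
  "right_octonion_module (\<lambda>c f x. c *\<^sub>R f x) (Hom_LO smul) (hom_smul smul)"
proof (intro right_octonion_module.intro right_octonion_module_axioms.intro)
  show "vector_space (\<lambda>c (f :: 'm \<Rightarrow> octonion) x. c *\<^sub>R f x)"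
    by (rule vector_space_pointwise_scaleR)
  then interpret F: vector_space "\<lambda>c (f :: 'm \<Rightarrow> octonion) x. c *\<^sub>R f x" .
  show "F.subspace (Hom_LO smul)"
    by (intro F.subspaceI Hom_LO_zero Hom_LO_add Hom_LO_scale)
  \<comment> \<open>The closure facts discharge the membership premise of
    \<open>oct_Re_hom_smul\<close>, also for nested uses of \<open>hom_smul\<close>.\<close>
  note Re = oct_Re_hom_smul hom_smul_closed Hom_LO_add Hom_LO_scale
  fix f g :: "'m \<Rightarrow> octonion" and p q r :: octonion and c :: real
  assume f: "f \<in> Hom_LO smul"
  note lin = linear_add[OF Hom_LO_linear[OF f]] linear_scale[OF Hom_LO_linear[OF f]]
  show "hom_smul smul f r \<in> Hom_LO smul"
    by (rule hom_smul_closed[OF f])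
  show "hom_smul smul f (p + q) = hom_smul smul f p + hom_smul smul f q"
    by (rule Hom_LO_eqI[of _ smul]) (simp_all add: f Re add_scalar lin)
  show "hom_smul smul f (c *\<^sub>R r) = (\<lambda>x. c *\<^sub>R hom_smul smul f r x)"
    by (rule Hom_LO_eqI[of _ smul]) (simp_all add: f Re scale_scalar lin)
  show "hom_smul smul (\<lambda>x. c *\<^sub>R f x) r = (\<lambda>x. c *\<^sub>R hom_smul smul f r x)"
    by (rule Hom_LO_eqI[of _ smul]) (simp_all add: f Re)
  show "hom_smul smul f 1 = f"
    by (rule Hom_LO_eqI[of _ smul]) (simp_all add: f Re one)
  show "hom_smul smul (hom_smul smul f r) r = hom_smul smul f (r * r)"
    by (rule Hom_LO_eqI[of _ smul]) (simp_all add: f Re alternative)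
  assume g: "g \<in> Hom_LO smul"
  show "hom_smul smul (f + g) r = hom_smul smul f r + hom_smul smul g r"
    by (rule Hom_LO_eqI[of _ smul]) (simp_all add: f g Re)
qed

end

theorem theorem3p10:
  fixes smul :: "octonion \<Rightarrow> 'm::real_vector \<Rightarrow> 'm"
  assumes "left_octonion_module scaleR UNIV smul"
  shows "right_octonion_module (\<lambda>c f x. c *\<^sub>R f x) (Hom_LO smul) (hom_smul smul)"
  using assms by (intro full_left_octonion_module.right_octonion_module_Hom_LO
      full_left_octonion_module.intro)

end
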